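(* Let $k \geq 2$ and let $G$ be a complete $k$-partite graph (with all parts nonempty) that is not the complete graph $K_k$. Then $\mathrm{lir}(G) \leq 2$, i.e., the edges of $G$ can be colored with at most two colors so that each color class induces a locally irregular subgraph.
   Context: A graph is locally irregular if the two endvertices of every edge have different degrees. A locally irregular edge coloring of $G$ is an edge coloring in which every color class induces a locally irregular subgraph; $\mathrm{lir}(G)$ is the minimum number of colors in such a coloring. *)

theory Defs
  imports Main "HOL-Library.Ramsey" "HOL-Library.Disjoint_Sets" "HOL-Library.FuncSet"
    "HOL-Library.Extended_Nat"
begin

record 'a graph =
  verts :: "'a set"
  edges :: "'a set set"

definition finite_simple_graph :: "'a graph \<Rightarrow> bool" where
  "finite_simple_graph G \<longleftrightarrow> finite (verts G) \<and> edges G \<subseteq> nsets (verts G) 2"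

definition degree :: "'a graph \<Rightarrow> 'a \<Rightarrow> nat" where
  "degree G v = card {e \<in> edges G. v \<in> e}"

definition locally_irregular :: "'a graph \<Rightarrow> bool" where
  "locally_irregular G \<longleftrightarrow> (\<forall>u v. {u, v} \<in> edges G \<longrightarrow> degree G u \<noteq> degree G v)"

definition induced_by_edges :: "'a set set \<Rightarrow> 'a graph" where
  "induced_by_edges F = \<lparr>verts = \<Union>F, edges = F\<rparr>"

text \<open>Colors may be unused: an empty class induces the empty graph, which is vacuously
  locally irregular. The coloring need not be proper.\<close>

definition locally_irregular_edge_coloring :: "'a graph \<Rightarrow> nat \<Rightarrow> ('a set \<Rightarrow> nat) \<Rightarrow> bool" where
  "locally_irregular_edge_coloring G n c \<longleftrightarrow>
     c \<in> edges G \<rightarrow> {..<n} \<and>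
     (\<forall>i<n. locally_irregular (induced_by_edges {e \<in> edges G. c e = i}))"

text \<open>The value is \<open>\<infinity>\<close> for graphs admitting no such coloring, for example a single edge.\<close>

definition lir :: "'a graph \<Rightarrow> enat" where
  "lir G = (INF n \<in> {n. \<exists>c. locally_irregular_edge_coloring G n c}. enat n)"

text \<open>Parts are nonempty, since \<^const>\<open>partition_on\<close> excludes the empty block.\<close>

definition complete_multipartite :: "nat \<Rightarrow> 'a graph \<Rightarrow> bool" where
  "complete_multipartite k G \<longleftrightarrow>
     (\<exists>P. partition_on (verts G) P \<and> card P = k \<and>
        edges G = {{u, v} | u v. \<exists>A\<in>P. \<exists>B\<in>P. A \<noteq> B \<and> u \<in> A \<and> v \<in> B})"

text \<open>Being \<open>K\<^sub>k\<close> is understood up to isomorphism.\<close>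

definition is_complete_graph :: "nat \<Rightarrow> 'a graph \<Rightarrow> bool" where
  "is_complete_graph k G \<longleftrightarrow> card (verts G) = k \<and> edges G = nsets (verts G) 2"

end

theory Submission imports Defs begin

text \<open>Colour the parts in order of decreasing size, joining each new part \<open>A\<close> to everything before it
  in a single colour and alternating the two colours. A join in colour \<open>j\<close> raises all old \<open>j\<close>-degrees
  by \<open>card A\<close>, so only new edges matter, and a conflict at an old vertex \<open>v\<close> means that the part of
  \<open>v\<close> has size \<open>card A\<close> and that \<open>v\<close> has degree \<open>0\<close> in the other colour. After each
  join every vertex has positive degree in the colour just used, so once started the process never
  fails. To start: a largest part of unique size; for two equal parts of size \<open>s \<ge> 2\<close>, a star
  in one of the colours; for three equal parts \<open>A, B, C\<close>, the complete bipartite graph on \<open>A, B\<close>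
  plus a perfect matching between \<open>A\<close> and \<open>C\<close>, with degrees \<open>s + 1, s, 1\<close> and
  \<open>s - 1, s, 2s - 1\<close> in the two colours.\<close>

section \<open>Colour degrees for families of parts\<close>

text \<open>The colouring argument works with families of parts rather than graphs, so that adding a
  part is just \<open>insert\<close>.\<close>

definition adj :: "'a set set \<Rightarrow> 'a \<Rightarrow> 'a \<Rightarrow> bool" where
  "adj P v w \<longleftrightarrow> (\<exists>A\<in>P. \<exists>B\<in>P. A \<noteq> B \<and> v \<in> A \<and> w \<in> B)"

definition cdeg :: "'a set set \<Rightarrow> ('a \<Rightarrow> 'a \<Rightarrow> bool) \<Rightarrow> bool \<Rightarrow> 'a \<Rightarrow> nat" where
  "cdeg P c i v = card {w. adj P v w \<and> c v w = i}"

text \<open>The two colours are the two truth values, and a symmetric relation stands for a function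
  on unordered pairs. Apart from the symmetry, its values on nonadjacent pairs are arbitrary,
  because \<open>cdeg\<close> counts adjacent vertices only.\<close>

definition irregular_colouring :: "'a set set \<Rightarrow> ('a \<Rightarrow> 'a \<Rightarrow> bool) \<Rightarrow> bool" where
  "irregular_colouring P c \<longleftrightarrow> symp c \<and>
     (\<forall>v w. adj P v w \<longrightarrow> cdeg P c (c v w) v \<noteq> cdeg P c (c v w) w)"

text \<open>The invariant of the induction: if every vertex has positive degree in colour
  \<open>i\<close>, then the next part can be joined in the other colour.\<close>

definition extendable :: "'a set set \<Rightarrow> bool" where
  "extendable P \<longleftrightarrow> (\<exists>c i. irregular_colouring P c \<and> (\<forall>v\<in>\<Union>P. cdeg P c i v > 0))"

definition fin_parts :: "'a set set \<Rightarrow> bool" where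
  "fin_parts P \<longleftrightarrow> finite P \<and> disjoint P \<and> (\<forall>A\<in>P. finite A \<and> A \<noteq> {})"

lemma fin_parts_subset: "fin_parts Q \<Longrightarrow> P \<subseteq> Q \<Longrightarrow> fin_parts P"
  using pairwise_subset[of disjnt Q P] finite_subset[of P Q] by (auto simp: fin_parts_def)

lemma adj_in_part:
  assumes "disjoint P" "A \<in> P" "v \<in> A"
  shows "adj P v w \<longleftrightarrow> w \<in> \<Union>P - A"
proof
  assume "adj P v w"
  then obtain X Y where XY: "X \<in> P" "Y \<in> P" "X \<noteq> Y" "v \<in> X" "w \<in> Y"
    by (auto simp: adj_def)
  moreover have "X = A" using disjointD[OF assms(1), of X A] XY assms by auto
  moreover have "A \<inter> Y = {}" using disjointD[OF assms(1), of A Y] XY \<open>X = A\<close> by auto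
  ultimately show "w \<in> \<Union>P - A" by auto
next
  show "w \<in> \<Union>P - A \<Longrightarrow> adj P v w"
    using assms by (auto simp: adj_def)
qed

lemma cdeg_eq_card:
  assumes "disjoint P" "A \<in> P" "v \<in> A"
  shows "cdeg P c i v = card {w \<in> \<Union>P - A. c v w = i}"
  unfolding cdeg_def using adj_in_part[OF assms] by simp

text \<open>A vertex of \<open>A\<close> is joined to everything outside \<open>A\<close>, so its
  degree in one colour determines its degree in the other.\<close>

lemma cdeg_sum:
  assumes "fin_parts P" "A \<in> P" "v \<in> A"
  shows "cdeg P c i v + cdeg P c (\<not> i) v + card A = card (\<Union>P)"
proof -
  have d: "disjoint P" and f: "finite (\<Union>P)" using assms(1) by (auto simp: fin_parts_def)
  let ?S = "\<lambda>i. {w \<in> \<Union>P - A. c v w = i}"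
  have "card (?S i) + card (?S (\<not> i)) = card (?S i \<union> ?S (\<not> i))"
    by (intro card_Un_disjoint[symmetric]) (auto intro: finite_subset[OF _ f])
  also have "?S i \<union> ?S (\<not> i) = \<Union>P - A" by auto
  also have "card (\<Union>P - A) + card A = card (\<Union>P)"
    using f assms(2) card_Diff_subset[of A "\<Union>P"] card_mono[of "\<Union>P" A]
    by (auto simp: Sup_upper finite_subset)
  finally show ?thesis
    using cdeg_eq_card[OF d assms(2,3)] by simp
qed

section \<open>Adding parts one at a time\<close>

text \<open>The new edges get colour \<open>\<not> i\<close>. Positivity is asked only at parts as
  large as \<open>A\<close>, so the lemma also starts the process from colourings in which some
  vertices have degree 0 in colour \<open>i\<close>, provided all old parts are strictly larger than
  \<open>A\<close>.\<close>

lemma monochromatic_join: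
  assumes P: "fin_parts (insert A P)" and A: "A \<notin> P" and ne: "P \<noteq> {}"
    and irr: "irregular_colouring P c"
    and le: "\<And>B. B \<in> P \<Longrightarrow> card A \<le> card B"
    and pos: "\<And>B v. B \<in> P \<Longrightarrow> v \<in> B \<Longrightarrow> card B = card A \<Longrightarrow> cdeg P c i v > 0"
  shows "extendable (insert A P)"
proof -
  let ?P = "insert A P"
  define c' where "c' v w = (if v \<in> A \<or> w \<in> A then \<not> i else c v w)" for v w
  have d': "disjoint ?P" and fin: "finite (\<Union>P)" "finite A" and A_ne: "A \<noteq> {}"
    and P': "fin_parts P"
    using P fin_parts_subset[OF P, of P] by (auto simp: fin_parts_def)
  have d: "disjoint P" using P' by (simp add: fin_parts_def)
  have AP: "A \<inter> \<Union>P = {}"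
    using disjointD[OF d', of A] A by auto
  have oldj: "cdeg ?P c' (\<not> i) v = cdeg P c (\<not> i) v + card A" if "B \<in> P" "v \<in> B" for B v
  proof -
    have "{w \<in> \<Union>?P - B. c' v w = (\<not> i)} = {w \<in> \<Union>P - B. c v w = (\<not> i)} \<union> A"
      using that AP by (auto simp: c'_def)
    moreover have "card \<dots> = card {w \<in> \<Union>P - B. c v w = (\<not> i)} + card A"
      using fin(2) AP by (intro card_Un_disjoint) (auto intro: finite_subset[OF _ fin(1)])
    ultimately show ?thesis
      using cdeg_eq_card[OF d that, of c "\<not> i"] cdeg_eq_card[OF d' _ that(2), of c' "\<not> i"] that(1)
      by simp
  qed
  have oldi: "cdeg ?P c' i v = cdeg P c i v" if "B \<in> P" "v \<in> B" for B v
  proof -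
    have "{w \<in> \<Union>?P - B. c' v w = i} = {w \<in> \<Union>P - B. c v w = i}"
      using that AP by (auto simp: c'_def)
    then show ?thesis
      using cdeg_eq_card[OF d that, of c i] cdeg_eq_card[OF d' _ that(2), of c' i] that(1)
      by simp
  qed
  have new: "cdeg ?P c' (\<not> i) v = card (\<Union>P)" if "v \<in> A" for v
  proof -
    have "{w \<in> \<Union>?P - A. c' v w = (\<not> i)} = \<Union>P"
      using that AP by (auto simp: c'_def)
    then show ?thesis
      using cdeg_eq_card[OF d' _ that, of c' "\<not> i"] by simp
  qed
  \<comment> \<open>By \<open>cdeg_sum\<close>, the right side is
    \<open>card (\<Union>P) - card B - cdeg P c i w + card A\<close>. Equality would force
    \<open>card A = card B + cdeg P c i w\<close>, which \<open>le\<close> and \<open>pos\<close>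
    exclude.\<close>
  have cross: "card (\<Union>P) \<noteq> cdeg ?P c' (\<not> i) w" if "B \<in> P" "w \<in> B" for B w
    using cdeg_sum[OF P' that, of c i] oldj[OF that] le[OF that(1)] pos[OF that] by linarith
  have sym: "symp c'"
    using irr unfolding irregular_colouring_def c'_def symp_def by auto
  have "cdeg ?P c' (c' v w) v \<noteq> cdeg ?P c' (c' v w) w" if "adj ?P v w" for v w
  proof -
    obtain X Y where XY: "X \<in> ?P" "Y \<in> ?P" "X \<noteq> Y" "v \<in> X" "w \<in> Y"
      using \<open>adj ?P v w\<close> by (auto simp: adj_def)
    consider "X = A" "Y \<in> P" | "Y = A" "X \<in> P" | "X \<in> P" "Y \<in> P"
      using XY by auto
    then show ?thesis
    proof cases
      case 1
      then show ?thesis using XY new cross[of Y w] by (simp add: c'_def)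
    next
      case 2
      then show ?thesis using XY new cross[of X v] by (simp add: c'_def)
    next
      case 3
      then have "v \<notin> A" "w \<notin> A" using XY AP by auto
      then have cc: "c' v w = c v w" by (simp add: c'_def)
      have "adj P v w" using 3 XY by (auto simp: adj_def)
      then have ne: "cdeg P c (c v w) v \<noteq> cdeg P c (c v w) w"
        using irr by (simp add: irregular_colouring_def)
      show ?thesis
      proof (cases "c v w = i")
        case True
        then show ?thesis using ne cc oldi 3 XY by simp
      next
        case False
        then have "c v w = (\<not> i)" by simp
        then show ?thesis using ne cc oldj 3 XY by simp
      qed
    qed
  qed
  \<comment> \<open>The colour just used becomes the new witness, so the two colours swap roles for
    the next join.\<close>
  moreover have "cdeg ?P c' (\<not> i) v > 0" if "v \<in> \<Union>?P" for v
  proof (cases "v \<in> A")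
    case True
    have "\<Union>P \<noteq> {}" using ne P' by (auto simp: fin_parts_def)
    then have "card (\<Union>P) > 0" using fin(1) by (simp add: card_gt_0_iff)
    then show ?thesis using new[OF True] by simp
  next
    case False
    then obtain B where B: "B \<in> P" "v \<in> B" using \<open>v \<in> \<Union>?P\<close> by auto
    have "card A > 0" using fin(2) A_ne by (simp add: card_gt_0_iff)
    then show ?thesis using oldj[OF B] by simp
  qed
  ultimately show ?thesis
    using sym unfolding extendable_def irregular_colouring_def by blast
qed

lemma ex_max_card:
  assumes "finite Q" "Q \<noteq> {}"
  obtains A where "A \<in> Q" "\<And>B. B \<in> Q \<Longrightarrow> card B \<le> card A"
proof -
  have "Max (card ` Q) \<in> card ` Q" using assms by simp
  then obtain A where "A \<in> Q" "card A = Max (card ` Q)" by auto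
  then show ?thesis using assms that by simp
qed

text \<open>Induction on the number of missing parts. Choosing a largest missing part keeps the size
  hypothesis true for the enlarged family.\<close>

lemma extendable_superset:
  assumes "extendable P" "P \<noteq> {}" "fin_parts Q" "P \<subseteq> Q"
    and "\<And>A B. A \<in> Q - P \<Longrightarrow> B \<in> P \<Longrightarrow> card A \<le> card B"
  shows "extendable Q"
  using assms
proof (induction "card (Q - P)" arbitrary: P)
  case 0
  then have "Q - P = {}" using card_0_eq[of "Q - P"] by (metis fin_parts_def finite_Diff)
  then have "Q = P" using 0(5) by blast
  then show ?case using 0(2) by simp
next
  case (Suc n)
  have fQ: "finite (Q - P)" using Suc.prems(3) by (simp add: fin_parts_def)
  have "Q - P \<noteq> {}" using Suc.hyps(2) by (metis card.empty nat.distinct(1))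
  then obtain A where A: "A \<in> Q - P" "\<And>B. B \<in> Q - P \<Longrightarrow> card B \<le> card A"
    by (rule ex_max_card[OF fQ]) blast
  obtain c i where c: "irregular_colouring P c" "\<forall>v\<in>\<Union>P. cdeg P c i v > 0"
    using Suc.prems(1) by (auto simp: extendable_def)
  have sub: "insert A P \<subseteq> Q" using A(1) Suc.prems(4) by auto
  then have "fin_parts (insert A P)"
    by (rule fin_parts_subset[OF Suc.prems(3)])
  then have ext: "extendable (insert A P)"
  proof (rule monochromatic_join)
    show "A \<notin> P" using A(1) by simp
    show "P \<noteq> {}" by (fact Suc.prems(2))
    show "irregular_colouring P c" by (fact c)
    show "card A \<le> card B" if "B \<in> P" for B by (rule Suc.prems(5)[OF A(1) that])
    show "cdeg P c i v > 0" if "B \<in> P" "v \<in> B" for B v using c(2) that by blast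
  qed
  have "Q - insert A P = Q - P - {A}" by blast
  then have n: "n = card (Q - insert A P)"
    using Suc.hyps(2) A(1) by simp
  have le: "card X \<le> card Y" if "X \<in> Q - insert A P" "Y \<in> insert A P" for X Y
  proof (cases "Y = A")
    case True
    then show ?thesis using A(2)[of X] that by simp
  next
    case False
    then show ?thesis using Suc.prems(5)[of X Y] that by simp
  qed
  show ?case
    by (rule Suc.hyps(1)[OF n ext _ Suc.prems(3) sub le]) simp_all
qed

section \<open>Starting configurations with equal parts\<close>

lemma irregular_colouring_star:
  assumes "fin_parts {A, B}" "A \<noteq> B" "card A = card B" "card A \<ge> 2"
  shows "\<exists>c. irregular_colouring {A, B} c"
proof -
  let ?P = "{A, B}"
  have d: "disjoint ?P" and fin: "finite A" "finite B"
    using assms by (auto simp: fin_parts_def)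
  have AB: "A \<inter> B = {}" using disjointD[OF d, of A B] assms by auto
  obtain a where a: "a \<in> A" using assms by fastforce
  \<comment> \<open>\<open>True\<close> is the star at \<open>a\<close>, and \<open>False\<close> is
    the complete bipartite graph between \<open>A - {a}\<close> and \<open>B\<close>. Here
    \<open>a\<close> has degree 0 in \<open>False\<close> and the rest of \<open>A\<close> has
    degree 0 in \<open>True\<close>, so neither colour witnesses \<open>extendable\<close>.\<close>
  define c where "c v w \<longleftrightarrow> v = a \<or> w = a" for v w
  have U: "\<Union>?P - A = B" "\<Union>?P - B = A" using AB by auto
  have dA: "cdeg ?P c i v = card {w \<in> B. c v w = i}" if "v \<in> A" for i v
    using cdeg_eq_card[OF d _ that, of c i] unfolding U by simp
  have dB: "cdeg ?P c i v = card {w \<in> A. c v w = i}" if "v \<in> B" for i v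
    using cdeg_eq_card[OF d _ that, of c i] unfolding U by simp
  have centre: "cdeg ?P c True a = card A"
  proof -
    have "{w \<in> B. c a w = True} = B" by (auto simp: c_def)
    then show ?thesis using dA[OF a, of True] assms by simp
  qed
  have far: "cdeg ?P c False v = card A" if "v \<in> A" "v \<noteq> a" for v
  proof -
    have "{w \<in> B. c v w = False} = B" using that a AB by (auto simp: c_def)
    then show ?thesis using dA[OF that(1), of False] assms by simp
  qed
  have leafT: "cdeg ?P c True v = 1" if "v \<in> B" for v
  proof -
    have "{w \<in> A. c v w = True} = {a}" using that a AB by (auto simp: c_def)
    then show ?thesis using dB[OF that, of True] by simp
  qed
  have leafF: "cdeg ?P c False v = card A - 1" if "v \<in> B" for v
  proof -
    have "{w \<in> A. c v w = False} = A - {a}" using that a AB by (auto simp: c_def)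
    then show ?thesis using dB[OF that, of False] fin a by simp
  qed
  have edge: "cdeg ?P c (c v w) v \<noteq> cdeg ?P c (c v w) w" if "v \<in> A" "w \<in> B" for v w
  proof (cases "v = a")
    case True
    then show ?thesis using centre leafT[OF that(2)] assms(4) by (simp add: c_def)
  next
    case False
    then have "\<not> c v w" using that a AB by (auto simp: c_def)
    then show ?thesis using far[OF that(1) False] leafF[OF that(2)] assms(4) by simp
  qed
  have sym: "c v w = c w v" for v w by (auto simp: c_def)
  have "cdeg ?P c (c v w) v \<noteq> cdeg ?P c (c v w) w" if "adj ?P v w" for v w
  proof -
    have "v \<in> A \<and> w \<in> B \<or> w \<in> A \<and> v \<in> B" using that by (auto simp: adj_def)
    then show ?thesis using edge[of v w] edge[of w v] sym[of v w] by auto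
  qed
  then show ?thesis using sym unfolding irregular_colouring_def symp_def by blast
qed

text \<open>The star colouring of two equal parts has vertices of degree 0 in each colour, so it
  does not meet the positivity hypothesis of \<open>monochromatic_join\<close> for a third part of
  the same size. The three parts are therefore coloured at once.\<close>

lemma extendable_three_equal:
  assumes "fin_parts {A, B, C}" "A \<noteq> B" "A \<noteq> C" "B \<noteq> C"
    and "card A = s" "card B = s" "card C = s" "s \<ge> 2"
  shows "extendable {A, B, C}"
proof -
  let ?P = "{A, B, C}"
  have d: "disjoint ?P" and fin: "finite A" "finite B" "finite C"
    using assms by (auto simp: fin_parts_def)
  have dis: "A \<inter> B = {}" "A \<inter> C = {}" "B \<inter> C = {}"
    using assms disjointD[OF d, of A B] disjointD[OF d, of A C] disjointD[OF d, of B C] by auto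
  have cardU: "card (\<Union>?P) = 3 * s"
  proof -
    have "card (\<Union>?P) = card A + card (B \<union> C)"
      using fin dis by (simp add: card_Un_disjoint Int_Un_distrib)
    then show ?thesis using fin dis assms by (simp add: card_Un_disjoint)
  qed
  obtain f where f: "bij_betw f C A"
    using finite_same_card_bij[OF fin(3,1)] assms by auto
  define c where "c v w \<longleftrightarrow> v \<in> A \<and> w \<in> B \<or> v \<in> B \<and> w \<in> A
    \<or> v \<in> C \<and> w = f v \<or> w \<in> C \<and> v = f w" for v w
  have fA: "f x \<in> A" if "x \<in> C" for x using f that by (auto simp: bij_betw_def)
  have sym: "c v w = c w v" for v w by (auto simp: c_def)
  have TA: "cdeg ?P c True v = s + 1" if "v \<in> A" for v
  proof -
    obtain x where x: "x \<in> C" "f x = v"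
      using \<open>v \<in> A\<close> bij_betw_imp_surj_on[OF f] by blast
    have uniq: "y = x" if "y \<in> C" "v = f y" for y
      using inj_onD[OF bij_betw_imp_inj_on[OF f], of y x] x that by simp
    have "v \<notin> B" "v \<notin> C" using that dis by auto
    moreover have "w \<in> C \<and> v = f w \<longleftrightarrow> w = x" for w using uniq x by blast
    ultimately have "c v w \<longleftrightarrow> w \<in> B \<or> w = x" for w
      using that by (simp add: c_def)
    then have "{w \<in> \<Union>?P - A. c v w = True} = insert x B"
      using dis x(1) by auto
    moreover have "x \<notin> B" using x dis by auto
    ultimately show ?thesis
      using cdeg_eq_card[OF d _ that, of c True] fin assms by simp
  qed
  have TB: "cdeg ?P c True v = s" if "v \<in> B" for v
  proof -
    have "v \<notin> A" "v \<notin> C" using that dis by auto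
    then have "c v w \<longleftrightarrow> w \<in> A" for w
      using that fA[of w] by (auto simp: c_def)
    then have "{w \<in> \<Union>?P - B. c v w = True} = A"
      using dis by auto
    then show ?thesis
      using cdeg_eq_card[OF d _ that, of c True] assms by simp
  qed
  have TC: "cdeg ?P c True v = 1" if "v \<in> C" for v
  proof -
    have "v \<notin> A" "v \<notin> B" using that dis by auto
    then have "c v w \<longleftrightarrow> w = f v" if "w \<notin> C" for w
      using \<open>v \<in> C\<close> that by (auto simp: c_def)
    then have "{w \<in> \<Union>?P - C. c v w = True} = {f v}"
      using dis fA[OF that] by auto
    then show ?thesis
      using cdeg_eq_card[OF d _ that, of c True] by simp
  qed
  \<comment> \<open>Every vertex has total degree \<open>2 * s\<close>, so these values are
    complements of the previous three.\<close>
  have FA: "cdeg ?P c False v = s - 1" if "v \<in> A" for v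
    using cdeg_sum[OF assms(1) _ that, of c True] TA[OF that] cardU assms by simp
  have FB: "cdeg ?P c False v = s" if "v \<in> B" for v
    using cdeg_sum[OF assms(1) _ that, of c True] TB[OF that] cardU assms by simp
  have FC: "cdeg ?P c False v = 2 * s - 1" if "v \<in> C" for v
    using cdeg_sum[OF assms(1) _ that, of c True] TC[OF that] cardU assms by simp
  \<comment> \<open>In either colour the degree depends only on the part, and
    \<open>s \<ge> 2\<close> makes the three values distinct. Hence the claim holds for both
    \<open>i\<close>, whatever the colour of the edge.\<close>
  have "cdeg ?P c i v \<noteq> cdeg ?P c i w" if "adj ?P v w" for v w i
  proof -
    consider "v \<in> A" "w \<in> B" | "v \<in> A" "w \<in> C" | "v \<in> B" "w \<in> A" | "v \<in> B" "w \<in> C"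
      | "v \<in> C" "w \<in> A" | "v \<in> C" "w \<in> B"
      using \<open>adj ?P v w\<close> by (auto simp: adj_def)
    then show ?thesis
      by cases (cases i; use assms(8) in \<open>simp add: TA TB TC FA FB FC\<close>)+
  qed
  moreover have "cdeg ?P c True v > 0" if "v \<in> \<Union>?P" for v
    using that assms(8) by (auto simp: TA TB TC)
  ultimately show ?thesis
    using sym unfolding extendable_def irregular_colouring_def symp_def by blast
qed

text \<open>The cases follow the three largest sizes: no tie at the top, a tie of two with no
  further part or a smaller third one, and a tie of three.\<close>

lemma ex_irregular_colouring:
  assumes Q: "fin_parts Q" "card Q \<ge> 2" and big: "X \<in> Q" "card X \<ge> 2"
  shows "\<exists>c. irregular_colouring Q c"
proof -
  have fQ: "finite Q" using Q(1) by (simp add: fin_parts_def)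
  obtain A where A: "A \<in> Q" and A_max: "\<And>B. B \<in> Q \<Longrightarrow> card B \<le> card A"
    by (rule ex_max_card[OF fQ]) (use big(1) in auto)
  have A2: "card A \<ge> 2" using A_max[OF big(1)] big(2) by simp
  have ne1: "Q - {A} \<noteq> {}"
  proof
    assume "Q - {A} = {}"
    then have "Q = {A}" using A by blast
    then show False using Q(2) by simp
  qed
  obtain B where B: "B \<in> Q - {A}" and B_max: "\<And>Y. Y \<in> Q - {A} \<Longrightarrow> card Y \<le> card B"
    by (rule ex_max_card[OF _ ne1]) (use fQ in auto)
  have AB: "fin_parts {B, A}" "fin_parts {A, B}" "A \<noteq> B"
    using fin_parts_subset[OF Q(1), of "{A, B}"] A B by (auto simp: insert_commute)
  have BA: "card B \<le> card A" using A_max B by simp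
  have ext: "\<exists>c. irregular_colouring Q c"
    if "extendable P" "P \<noteq> {}" "P \<subseteq> Q" "\<And>Y Z. Y \<in> Q - P \<Longrightarrow> Z \<in> P \<Longrightarrow> card Y \<le> card Z" for P
    using extendable_superset[OF that(1,2) Q(1) that(3,4)] unfolding extendable_def by blast
  show ?thesis
  proof (cases "card A = card B")
    case False
    show ?thesis
    proof (rule ext)
      show "extendable {B, A}"
      proof (rule monochromatic_join)
        \<comment> \<open>A single part spans no edges, and the positivity hypothesis of the join is
          vacuous because \<open>card B < card A\<close>.\<close>
        show "irregular_colouring {A} (\<lambda>v w. True)"
          by (auto simp: irregular_colouring_def adj_def symp_def)
      qed (use AB BA False in auto)
      show "card Y \<le> card Z" if "Y \<in> Q - {B, A}" "Z \<in> {B, A}" for Y Z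
        using A_max[of Y] B_max[of Y] that by auto
    qed (use A B in auto)
  next
    case eq: True
    obtain c where c: "irregular_colouring {A, B} c"
      using irregular_colouring_star[OF AB(2,3) eq A2] by blast
    show ?thesis
    proof (cases "Q = {A, B}")
      case True
      then show ?thesis using c by blast
    next
      case False
      then have ne2: "Q - {A, B} \<noteq> {}" using A B by blast
      obtain C where C: "C \<in> Q - {A, B}" and C_max: "\<And>Y. Y \<in> Q - {A, B} \<Longrightarrow> card Y \<le> card C"
        by (rule ex_max_card[OF _ ne2]) (use fQ in auto)
      have ABC: "fin_parts {A, B, C}" "fin_parts {C, A, B}"
        using fin_parts_subset[OF Q(1), of "{A, B, C}"] A B C by (auto simp: insert_commute)
      have CA: "card C \<le> card A" using A_max C by simp
      show ?thesis
      proof (rule ext)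
        show "extendable {C, A, B}"
        proof (cases "card C = card A")
          case True
          have "extendable {A, B, C}"
            by (rule extendable_three_equal[OF ABC(1) AB(3) _ _ refl _ True A2])
              (use C eq in auto)
          then show ?thesis by (simp add: insert_commute)
        next
          case False
          show ?thesis
          proof (rule monochromatic_join[OF ABC(2) _ _ c])
            show "card C \<le> card Z" if "Z \<in> {A, B}" for Z using that CA eq by auto
            \<comment> \<open>Vacuous, since \<open>C\<close> is strictly smaller than both
              \<open>A\<close> and \<open>B\<close>; the colour \<open>True\<close> is an arbitrary
              choice.\<close>
            show "cdeg {A, B} c True v > 0" if "Z \<in> {A, B}" "card Z = card C" for Z v
              using that False eq by auto
          qed (use C in auto)
        qed
        show "card Y \<le> card Z" if "Y \<in> Q - {C, A, B}" "Z \<in> {C, A, B}" for Y Z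
          using A_max[of Y] B_max[of Y] C_max[of Y] that by auto
      qed (use A B C in auto)
    qed
  qed
qed

section \<open>Transfer to edge colourings of graphs\<close>

lemma lir_le_two:
  assumes disj: "disjoint P"
    and E: "edges G = {{u, v} | u v. adj P u v}"
    and c: "irregular_colouring P c"
  shows "lir G \<le> 2"
proof -
  \<comment> \<open>An edge carries no order of its ends, so some ordering is quantified over;
    symmetry of \<open>c\<close> makes the choice irrelevant.\<close>
  define col :: "'a set \<Rightarrow> nat" where
    "col e = (if \<exists>u v. e = {u, v} \<and> c u v then 0 else 1)" for e
  have sym: "c u v = c v u" for u v
    using c unfolding irregular_colouring_def symp_def by blast
  have col: "col {u, v} = (if c u v then 0 else 1)" for u v
    using sym by (auto simp: col_def doubleton_eq_iff)
  have adj_sym: "adj P u v = adj P v u" for u v by (auto simp: adj_def)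
  have edge: "{u, v} \<in> edges G \<longleftrightarrow> adj P u v" for u v
    using adj_sym by (auto simp: E doubleton_eq_iff)
  have deg: "degree (induced_by_edges {e \<in> edges G. col e = (if i then 0 else 1)}) v = cdeg P c i v"
    for i v
  proof -
    \<comment> \<open>The map from \<open>w\<close> to \<open>{v, w}\<close> matches the neighbours
      of \<open>v\<close> in colour \<open>i\<close> with the edges of that colour at
      \<open>v\<close>.\<close>
    have "{e \<in> {e \<in> edges G. col e = (if i then 0 else 1)}. v \<in> e}
        = (\<lambda>w. {v, w}) ` {w. adj P v w \<and> c v w = i}" (is "?L = ?R")
    proof (intro set_eqI iffI)
      fix e assume e: "e \<in> ?L"
      then obtain x y where "e = {x, y}" by (auto simp: E)
      then obtain w where w: "e = {v, w}" using e by (auto simp: insert_commute)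
      then show "e \<in> ?R" using e edge col by (auto split: if_splits)
    next
      fix e assume "e \<in> ?R"
      then show "e \<in> ?L" using edge col by auto
    qed
    moreover have "inj_on (\<lambda>w. {v, w}) {w. adj P v w \<and> c v w = i}"
      by (auto simp: inj_on_def doubleton_eq_iff)
    ultimately show ?thesis
      by (simp add: degree_def induced_by_edges_def cdeg_def card_image)
  qed
  have "locally_irregular (induced_by_edges {e \<in> edges G. col e = (if i then 0 else 1)})" for i
    unfolding locally_irregular_def deg
  proof (intro allI impI)
    fix u v
    assume "{u, v} \<in> edges (induced_by_edges {e \<in> edges G. col e = (if i then 0 else 1)})"
    then have "adj P u v" "c u v = i"
      using edge col by (auto simp: induced_by_edges_def split: if_splits)
    then show "cdeg P c i u \<noteq> cdeg P c i v"
      using c unfolding irregular_colouring_def by blast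
  qed
  from this[of True] this[of False]
  have "locally_irregular_edge_coloring G 2 col"
    unfolding locally_irregular_edge_coloring_def
    by (auto simp: col_def less_2_cases_iff)
  then have "lir G \<le> enat 2"
    unfolding lir_def by (intro INF_lower) auto
  then show ?thesis by (simp add: numeral_eq_enat)
qed

text \<open>With singleton parts, adjacency is just inequality. The contrapositive yields a part of
  size other than 1 in the main proof.\<close>

lemma singleton_parts_imp_complete:
  assumes P: "partition_on (verts G) P" and fin: "finite (verts G)"
    and E: "edges G = {{u, v} | u v. adj P u v}"
    and one: "\<And>A. A \<in> P \<Longrightarrow> card A = 1"
  shows "is_complete_graph (card P) G"
proof -
  have U: "verts G = \<Union>P" and d: "disjoint P" using P by (auto simp: partition_on_def)
  have "P = (\<lambda>v. {v}) ` verts G"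
  proof (intro set_eqI iffI)
    fix A assume "A \<in> P"
    then obtain v where "A = {v}" using one card_1_singletonE by metis
    then show "A \<in> (\<lambda>v. {v}) ` verts G" using \<open>A \<in> P\<close> U by auto
  next
    fix A assume "A \<in> (\<lambda>v. {v}) ` verts G"
    then obtain v B where "A = {v}" "v \<in> B" "B \<in> P" using U by auto
    then show "A \<in> P" using one[of B] by (auto simp: card_1_singleton_iff)
  qed
  then have "adj P u v \<longleftrightarrow> u \<in> verts G \<and> v \<in> verts G \<and> u \<noteq> v" for u v
    by (auto simp: adj_def)
  then have "edges G = nsets (verts G) 2"
    unfolding E nsets_def by (force simp: card_2_iff)
  moreover have "card P = card (verts G)"
    using \<open>P = _\<close> card_image[of "\<lambda>v. {v}" "verts G"] by simp
  ultimately show ?thesis by (simp add: is_complete_graph_def)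
qed

theorem mainTheorem7:
  fixes G :: "'a graph" and k :: nat
  assumes "k \<ge> 2"
    and "finite_simple_graph G"
    and "complete_multipartite k G"
    and "\<not> is_complete_graph k G"
  shows "lir G \<le> 2"
proof -
  obtain P where P: "partition_on (verts G) P" "card P = k"
    and E: "edges G = {{u, v} | u v. adj P u v}"
    using assms(3) unfolding complete_multipartite_def adj_def by blast
  have fin: "finite (verts G)" using assms(2) by (simp add: finite_simple_graph_def)
  have parts: "fin_parts P"
    using P(1) fin finite_elements[OF fin P(1)] unfolding fin_parts_def partition_on_def
    by (auto intro: finite_subset[OF Sup_upper])
  obtain X where X: "X \<in> P" "card X \<noteq> 1"
    using singleton_parts_imp_complete[OF P(1) fin E] assms(4) P(2) by blast
  \<comment> \<open>Size 0 would mean an empty or infinite part, and \<open>fin_parts\<close>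
    excludes both.\<close>
  then have "card X > 0" using parts by (auto simp: fin_parts_def card_gt_0_iff)
  then have "card X \<ge> 2" using X by linarith
  then obtain c where "irregular_colouring P c"
    using ex_irregular_colouring parts P(2) assms(1) X by blast
  then show ?thesis
    using lir_le_two E parts unfolding fin_parts_def by blast
qed

end
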